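(* Let $\mathrm{Var}$ be a binary quadratic operad over a field of characteristic $0$ with $S_3$-module of (quadratic) defining relations $R\subseteq E=E_1\oplus E_2\oplus E_3$, and let $\pi_k:R\to E_k$, $k=1,2,3$, be the projections along this decomposition. Then the space of (quadratic, i.e. arity $3$) defining relations of the operad $\mathrm{pre}\mathrm{Var}^{\mathrm I}$ of initial $\mathrm{pre}\mathrm{Var}$-algebras consists of all elements $$f_1^{(1)}+f_2^{(2)}+f_3^{(3)},\qquad f_k\in \pi_k^{-1}[\pi_k(f)]=f+\ker\pi_k\ \ (k=1,2,3),\quad f\in R.$$
   Context: Let $\mu_i$, $i\in I$, be a basis of $\mathrm{Var}(2)$ such that for each $i$ there is $j$ with $\mu_i^{(12)}=\pm\mu_j$ (so the family of operations is closed, up to sign, under taking opposites). $E$ is the $S_3$-module of all multilinear degree $3$ expressions in $x_1,x_2,x_3$ in the free algebra with operations $\mu_i$ (modulo the symmetries $\mu_i^{(12)}=\pm\mu_j$). It decomposes as $E=E_1\oplus E_2\oplus E_3$, where $E_k$ is spanned by the monomials $\mu_i(\mu_j(x_a,x_b),x_k)$ with $\{a,b,k\}=\{1,2,3\}$, i.e. those with "external" letter $x_k$. $R\subseteq E$ is the $S_3$-submodule of relations defining $\mathrm{Var}$. Splitting: introduce operations $\mu_i^\succ,\mu_i^\prec$, $i\in I$, with $(\mu_i^\succ)^{(12)}=\pm\mu_j^\prec$ whenever $\mu_i^{(12)}=\pm\mu_j$, and put $\mu_i^*=\mu_i^\succ+\mu_i^\prec$. For a multilinear $f(x_1,\dots,x_n)$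 in the operations $\mu_i$ let $f^{( * )}$ be obtained by replacing each $\mu_i$ by $\mu_i^*$. For $k=1,\dots,n$ define $f^{(k)}$ linearly and inductively: $x_k^{(k)}=x_k$; if $f=\mu_i(g,h)$ and $x_k$ occurs in $h$ then $f^{(k)}=\mu_i^\succ(g^{( * )},h^{(k)})$; if $x_k$ occurs in $g$ then $f^{(k)}=\mu_i^\prec(g^{(k)},h^{( * )})$. $\mathrm{pre}\mathrm{Var}$ is the variety of algebras with operations $\mu_i^\succ,\mu_i^\prec$ defined by all identities $f^{(k)}=0$, where $f$ ranges over the multilinear defining identities of $\mathrm{Var}$ and $k=1,\dots,\deg f$. For a multilinear expression $\Phi$ in the operations $\mu_i^\succ,\mu_i^\prec$, let $\overline\Phi$ be the expression in the $\mu_i$ obtained by removing all superscripts $\succ,\prec$. An initial $\mathrm{pre}\mathrm{Var}$-algebra is an algebra with operations $\mu_i^\succ,\mu_i^\prec$ satisfying all those multilinear identities $\Phi$ of $\mathrm{pre}\mathrm{Var}$-algebras for which $\overline\Phi$ holds on $\mathrm{Var}$. For quadratic $\mathrm{Var}$ the operad $\mathrm{pre}\mathrm{Var}^{\mathrm I}$ is a binary quadratic operad, and its space of defining relations is the set of multilinear degree $3$ identities $\Phi$ of $\mathrm{pre}\mathrm{Var}$ such that $\overline\Phi\in R$. *)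

theory Defs
  imports Complex_Main "HOL-Library.Poly_Mapping" "HOL-Combinatorics.Permutations"
begin

section \<open>Formal expressions\<close>

datatype 'j mon = Letter nat | Op 'j "'j mon" "'j mon"

text \<open>
  Vectors over a field \<open>'k\<close> with basis \<open>'a\<close> are finitely supported functions. In particular
  \<open>('j, 'k) expr\<close> is the free nonassociative algebra over \<open>'k\<close> with operations indexed by \<open>'j\<close>
  and letters \<open>x\<^sub>0, x\<^sub>1, \<dots>\<close>, before any symmetries of the operations are imposed.
\<close>

type_synonym ('j, 'k) expr = "'j mon \<Rightarrow>\<^sub>0 'k"

definition scale :: "'k::field \<Rightarrow> ('a \<Rightarrow>\<^sub>0 'k) \<Rightarrow> ('a \<Rightarrow>\<^sub>0 'k)" where
  "scale c p = Poly_Mapping.map (\<lambda>x. c * x) p"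

lemma lookup_scale: "Poly_Mapping.lookup (scale c p) t = c * Poly_Mapping.lookup p t"
  by (simp add: scale_def Poly_Mapping.map.rep_eq when_def)

interpretation fs: vector_space "scale :: 'k::field \<Rightarrow> ('a \<Rightarrow>\<^sub>0 'k) \<Rightarrow> ('a \<Rightarrow>\<^sub>0 'k)"
  by unfold_locales
    (auto intro!: poly_mapping_eqI simp: lookup_scale lookup_add algebra_simps)

definition linear_ext :: "('a \<Rightarrow> ('b \<Rightarrow>\<^sub>0 'k::field)) \<Rightarrow> ('a \<Rightarrow>\<^sub>0 'k) \<Rightarrow> ('b \<Rightarrow>\<^sub>0 'k)" where
  "linear_ext F p = (\<Sum>t\<in>Poly_Mapping.keys p. scale (Poly_Mapping.lookup p t) (F t))"

abbreviation mon_expr :: "'j mon \<Rightarrow> ('j, 'k::field) expr" where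
  "mon_expr t \<equiv> Poly_Mapping.single t 1"

definition prod_expr :: "'j \<Rightarrow> ('j, 'k::field) expr \<Rightarrow> ('j, 'k) expr \<Rightarrow> ('j, 'k) expr" where
  "prod_expr j p q =
    (\<Sum>s\<in>Poly_Mapping.keys p. \<Sum>t\<in>Poly_Mapping.keys q. scale (Poly_Mapping.lookup p s * Poly_Mapping.lookup q t) (mon_expr (Op j s t)))"

primrec leaves :: "'j mon \<Rightarrow> nat list" where
  "leaves (Letter n) = [n]"
| "leaves (Op j s t) = leaves s @ leaves t"

definition multilinear_mons :: "nat \<Rightarrow> 'j mon set" where
  "multilinear_mons n = {t. distinct (leaves t) \<and> set (leaves t) = {1..n}}"

definition multilinear :: "nat \<Rightarrow> ('j, 'k::field) expr set" where
  "multilinear n = {p. Poly_Mapping.keys p \<subseteq> multilinear_mons n}"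

primrec rename_mon :: "(nat \<Rightarrow> nat) \<Rightarrow> 'j mon \<Rightarrow> 'j mon" where
  "rename_mon \<pi> (Letter n) = Letter (\<pi> n)"
| "rename_mon \<pi> (Op j s t) = Op j (rename_mon \<pi> s) (rename_mon \<pi> t)"

definition rename :: "(nat \<Rightarrow> nat) \<Rightarrow> ('j, 'k::field) expr \<Rightarrow> ('j, 'k) expr" where
  "rename \<pi> = linear_ext (\<lambda>t. mon_expr (rename_mon \<pi> t))"


section \<open>Symmetries of the operations\<close>

text \<open>
  A family of operations closed under opposites up to sign is described by \<open>\<sigma>\<close> and \<open>\<epsilon>\<close>:
  the opposite operation \<open>(x, y) \<mapsto> \<mu>\<^sub>j(y, x)\<close> is \<open>\<epsilon> j\<close> times the operation with index \<open>\<sigma> j\<close>.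
  For a basis of a space of operations the conditions below follow from applying the
  transposition twice, and \<open>\<sigma>, \<epsilon>\<close> determine the space as a module over the symmetric group.
\<close>

definition opposite_data :: "('j \<Rightarrow> 'j) \<Rightarrow> ('j \<Rightarrow> 'k::field) \<Rightarrow> bool" where
  "opposite_data \<sigma> \<epsilon> \<longleftrightarrow>
    (\<forall>j. \<sigma> (\<sigma> j) = j \<and> (\<epsilon> j = 1 \<or> \<epsilon> j = - 1) \<and> \<epsilon> (\<sigma> j) = \<epsilon> j)"

text \<open>
  \<open>opp_step \<sigma> \<epsilon> t c t'\<close>: applying the symmetry at one node turns the monomial \<open>t\<close> into
  \<open>c\<close> times \<open>t'\<close>.
\<close>

inductive opp_step :: "('j \<Rightarrow> 'j) \<Rightarrow> ('j \<Rightarrow> 'k) \<Rightarrow> 'j mon \<Rightarrow> 'k \<Rightarrow> 'j mon \<Rightarrow> bool"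
  for \<sigma> :: "'j \<Rightarrow> 'j" and \<epsilon> :: "'j \<Rightarrow> 'k" where
  root: "opp_step \<sigma> \<epsilon> (Op j s t) (\<epsilon> j) (Op (\<sigma> j) t s)"
| left: "opp_step \<sigma> \<epsilon> s c s' \<Longrightarrow> opp_step \<sigma> \<epsilon> (Op j s t) c (Op j s' t)"
| right: "opp_step \<sigma> \<epsilon> t c t' \<Longrightarrow> opp_step \<sigma> \<epsilon> (Op j s t) c (Op j s t')"

text \<open>
  The space of multilinear degree \<open>n\<close> expressions in the free algebra whose operations have the
  prescribed symmetries is the quotient of \<open>multilinear n\<close> by \<open>symmetries \<sigma> \<epsilon> n\<close>. Elements of the
  quotient are handled through representatives: equality is \<open>equal_mod\<close>, and a subspace is
  given by its preimage, that is, by a subspace of \<open>multilinear n\<close> containing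
  \<open>symmetries \<sigma> \<epsilon> n\<close>.
\<close>

definition symmetries :: "('j \<Rightarrow> 'j) \<Rightarrow> ('j \<Rightarrow> 'k::field) \<Rightarrow> nat \<Rightarrow> ('j, 'k) expr set" where
  "symmetries \<sigma> \<epsilon> n =
    fs.span {mon_expr t - scale c (mon_expr t') | t c t'. t \<in> multilinear_mons n \<and> opp_step \<sigma> \<epsilon> t c t'}"

definition equal_mod ::
    "('j \<Rightarrow> 'j) \<Rightarrow> ('j \<Rightarrow> 'k::field) \<Rightarrow> nat \<Rightarrow> ('j, 'k) expr \<Rightarrow> ('j, 'k) expr \<Rightarrow> bool" where
  "equal_mod \<sigma> \<epsilon> n p q \<longleftrightarrow> p - q \<in> symmetries \<sigma> \<epsilon> n"

definition quadratic_relations ::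
    "('j \<Rightarrow> 'j) \<Rightarrow> ('j \<Rightarrow> 'k::field) \<Rightarrow> ('j, 'k) expr set \<Rightarrow> bool" where
  "quadratic_relations \<sigma> \<epsilon> R \<longleftrightarrow>
    fs.subspace R \<and> symmetries \<sigma> \<epsilon> 3 \<subseteq> R \<and> R \<subseteq> multilinear 3 \<and>
    (\<forall>\<pi>. \<pi> permutes {1..3} \<longrightarrow> rename \<pi> ` R \<subseteq> R)"

text \<open>
  Projection of \<open>multilinear 3\<close> onto the span of the monomials with external letter \<open>x\<^sub>k\<close>.
  Modulo symmetries \<open>\<mu>\<^sub>i(x\<^sub>k, \<mu>\<^sub>j(x\<^sub>a, x\<^sub>b))\<close> is \<open>\<plusminus>\<mu>\<^sub>l(\<mu>\<^sub>j(x\<^sub>a, x\<^sub>b), x\<^sub>k)\<close> with \<open>l = \<sigma> i\<close>,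
  so monomials of both shapes belong to the \<open>k\<close>-th component.
\<close>

definition external_letter :: "'j mon \<Rightarrow> nat \<Rightarrow> bool" where
  "external_letter t k \<longleftrightarrow> (\<exists>i s. t = Op i s (Letter k) \<or> t = Op i (Letter k) s)"

definition proj :: "nat \<Rightarrow> ('j, 'k::field) expr \<Rightarrow> ('j, 'k) expr" where
  "proj k = linear_ext (\<lambda>t. if external_letter t k then mon_expr t else 0)"


section \<open>Algebras and identities\<close>

text \<open>
  The underlying space of an algebra is a subspace \<open>A\<close> of \<open>'x \<Rightarrow>\<^sub>0 'k\<close>; up to isomorphism these are
  all vector spaces of dimension at most the cardinality of \<open>'x\<close>. An identity involves finitely
  many letters, so it is tested on countably generated algebras, and these all occur as soon
  as there are at least as many elements of \<open>'x\<close> as there are monomials.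
\<close>

definition algebra ::
    "('j \<Rightarrow> 'j) \<Rightarrow> ('j \<Rightarrow> 'k::field) \<Rightarrow> ('x \<Rightarrow>\<^sub>0 'k) set \<Rightarrow>
     ('j \<Rightarrow> ('x \<Rightarrow>\<^sub>0 'k) \<Rightarrow> ('x \<Rightarrow>\<^sub>0 'k) \<Rightarrow> ('x \<Rightarrow>\<^sub>0 'k)) \<Rightarrow> bool" where
  "algebra \<sigma> \<epsilon> A m \<longleftrightarrow> fs.subspace A \<and>
    (\<forall>j. \<forall>a\<in>A. \<forall>b\<in>A. m j a b \<in> A \<and> m j b a = scale (\<epsilon> j) (m (\<sigma> j) a b)) \<and>
    (\<forall>j. \<forall>a\<in>A. \<forall>b\<in>A. \<forall>c\<in>A. m j (a + b) c = m j a c + m j b c \<and> m j c (a + b) = m j c a + m j c b) \<and>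
    (\<forall>j r. \<forall>a\<in>A. \<forall>b\<in>A. m j (scale r a) b = scale r (m j a b) \<and> m j a (scale r b) = scale r (m j a b))"

primrec eval_mon :: "('j \<Rightarrow> 'v \<Rightarrow> 'v \<Rightarrow> 'v) \<Rightarrow> (nat \<Rightarrow> 'v) \<Rightarrow> 'j mon \<Rightarrow> 'v" where
  "eval_mon m a (Letter n) = a n"
| "eval_mon m a (Op j s t) = m j (eval_mon m a s) (eval_mon m a t)"

definition satisfies ::
    "('x \<Rightarrow>\<^sub>0 'k::field) set \<Rightarrow> ('j \<Rightarrow> ('x \<Rightarrow>\<^sub>0 'k) \<Rightarrow> ('x \<Rightarrow>\<^sub>0 'k) \<Rightarrow> ('x \<Rightarrow>\<^sub>0 'k)) \<Rightarrow>
     ('j, 'k) expr \<Rightarrow> bool" where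
  "satisfies A m p \<longleftrightarrow> (\<forall>a. range a \<subseteq> A \<longrightarrow> linear_ext (eval_mon m a) p = 0)"

text \<open>
  The expressions that vanish on every algebra of the variety defined by the symmetries
  \<open>\<sigma>, \<epsilon>\<close> and the identities \<open>G\<close>. The first argument only fixes the type \<open>'x\<close>.
\<close>

definition identities ::
    "'x itself \<Rightarrow> ('j \<Rightarrow> 'j) \<Rightarrow> ('j \<Rightarrow> 'k::field) \<Rightarrow> ('j, 'k) expr set \<Rightarrow> ('j, 'k) expr set" where
  "identities _ \<sigma> \<epsilon> G =
    {p. \<forall>(A :: ('x \<Rightarrow>\<^sub>0 'k) set) m.
          algebra \<sigma> \<epsilon> A m \<and> (\<forall>g\<in>G. satisfies A m g) \<longrightarrow> satisfies A m p}"


section \<open>Splitting\<close>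

datatype half = Succ | Prec

primrec pre_opp :: "('i \<Rightarrow> 'i) \<Rightarrow> 'i \<times> half \<Rightarrow> 'i \<times> half" where
  "pre_opp \<sigma> (i, h) = (\<sigma> i, case h of Succ \<Rightarrow> Prec | Prec \<Rightarrow> Succ)"

definition pre_sign :: "('i \<Rightarrow> 'k) \<Rightarrow> 'i \<times> half \<Rightarrow> 'k" where
  "pre_sign \<epsilon> = \<epsilon> \<circ> fst"

primrec star_mon :: "'i mon \<Rightarrow> ('i \<times> half, 'k::field) expr" where
  "star_mon (Letter n) = mon_expr (Letter n)"
| "star_mon (Op i s t) =
    prod_expr (i, Succ) (star_mon s) (star_mon t) + prod_expr (i, Prec) (star_mon s) (star_mon t)"

text \<open>
  \<open>split_mon k t\<close> is only meaningful if \<open>k\<close> occurs exactly once in \<open>t\<close>; the recursion preserves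
  this, so the value at letters other than \<open>x\<^sub>k\<close> is irrelevant.
\<close>

primrec split_mon :: "nat \<Rightarrow> 'i mon \<Rightarrow> ('i \<times> half, 'k::field) expr" where
  "split_mon k (Letter n) = mon_expr (Letter n)"
| "split_mon k (Op i s t) =
    (if k \<in> set (leaves t)
     then prod_expr (i, Succ) (star_mon s) (split_mon k t)
     else prod_expr (i, Prec) (split_mon k s) (star_mon t))"

definition split_at :: "nat \<Rightarrow> ('i, 'k::field) expr \<Rightarrow> ('i \<times> half, 'k) expr" where
  "split_at k = linear_ext (split_mon k)"

definition pre_axioms :: "('i, 'k::field) expr set \<Rightarrow> ('i \<times> half, 'k) expr set" where
  "pre_axioms R = {split_at k f | k f. f \<in> R \<and> k \<in> {1..3}}"

definition bar :: "('i \<times> half, 'k::field) expr \<Rightarrow> ('i, 'k) expr" where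
  "bar = linear_ext (\<lambda>t. mon_expr (map_mon fst t))"

definition initial_axioms ::
    "'x itself \<Rightarrow> ('i \<Rightarrow> 'i) \<Rightarrow> ('i \<Rightarrow> 'k::field) \<Rightarrow> ('i, 'k) expr set \<Rightarrow> ('i \<times> half, 'k) expr set" where
  "initial_axioms X \<sigma> \<epsilon> R =
    {\<Phi>. (\<exists>n. \<Phi> \<in> multilinear n) \<and>
        \<Phi> \<in> identities X (pre_opp \<sigma>) (pre_sign \<epsilon>) (pre_axioms R) \<and>
        bar \<Phi> \<in> identities X \<sigma> \<epsilon> R}"

text \<open>
  The relations in arity 3 of the operad governing initial algebras: the kernel of the map onto
  it from the free operad, hence the multilinear degree 3 identities of these algebras.
\<close>

definition initial_relations ::
    "'x itself \<Rightarrow> ('i \<Rightarrow> 'i) \<Rightarrow> ('i \<Rightarrow> 'k::field) \<Rightarrow> ('i, 'k) expr set \<Rightarrow> ('i \<times> half, 'k) expr set" where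
  "initial_relations X \<sigma> \<epsilon> R =
    multilinear 3 \<inter> identities X (pre_opp \<sigma>) (pre_sign \<epsilon>) (initial_axioms X \<sigma> \<epsilon> R)"

end

theory Submission
  imports Defs
begin

text \<open>
  Viewing a \<open>Var\<close>-algebra as an algebra in which both halves of an operation act alike, the relations
  in question are the degree 3 identities \<open>\<Phi>\<close> of \<open>preVar\<close> whose bar is an identity of \<open>Var\<close>. Evaluating
  on a truncated free algebra, the degree 3 identities of \<open>Var\<close> are exactly \<open>R\<close>, and those of
  \<open>preVar\<close> are the sums \<open>f\<^sub>1\<^sup>(\<^sup>1\<^sup>) + f\<^sub>2\<^sup>(\<^sup>2\<^sup>) + f\<^sub>3\<^sup>(\<^sup>3\<^sup>)\<close> with \<open>f\<^sub>k \<in> R\<close>. The bar of \<open>f\<^sup>(\<^sup>k\<^sup>)\<close>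
  is \<open>f + \<pi>\<^sub>k f\<close>, so the bar of such a sum lies in \<open>R\<close> iff \<open>f = \<pi>\<^sub>1 f\<^sub>1 + \<pi>\<^sub>2 f\<^sub>2 + \<pi>\<^sub>3 f\<^sub>3\<close>
  does, and this \<open>f\<close> satisfies \<open>\<pi>\<^sub>k f = \<pi>\<^sub>k f\<^sub>k\<close>.
\<close>

section \<open>Linear and bilinear extension\<close>

abbreviation basis_vec :: "'a \<Rightarrow> ('a \<Rightarrow>\<^sub>0 'k::field)" where
  "basis_vec x \<equiv> Poly_Mapping.single x 1"

lemma linear_ext_superset:
  assumes "finite S" "Poly_Mapping.keys p \<subseteq> S"
  shows "linear_ext F p = (\<Sum>t\<in>S. scale (Poly_Mapping.lookup p t) (F t))"
  unfolding linear_ext_def using assms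
  by (intro sum.mono_neutral_left) (auto simp: in_keys_iff)

lemma linear_ext_add [simp]: "linear_ext F (p + q) = linear_ext F p + linear_ext F q"
proof -
  let ?S = "Poly_Mapping.keys p \<union> Poly_Mapping.keys q"
  have "Poly_Mapping.keys (p + q) \<subseteq> ?S"
    by (rule Poly_Mapping.keys_add)
  then show ?thesis
    by (simp add: linear_ext_superset[of ?S] lookup_add fs.scale_left_distrib sum.distrib)
qed

lemma linear_ext_scale [simp]: "linear_ext F (scale c p) = scale c (linear_ext F p)"
proof -
  have "Poly_Mapping.keys (scale c p) \<subseteq> Poly_Mapping.keys p"
    by (auto simp: in_keys_iff lookup_scale)
  then show ?thesis
    by (simp add: linear_ext_superset[of "Poly_Mapping.keys p"] lookup_scale fs.scale_sum_right)
qed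

lemma linear_ext_0 [simp]: "linear_ext F 0 = 0"
  by (simp add: linear_ext_def)

lemma linear_ext_diff [simp]: "linear_ext F (p - q) = linear_ext F p - linear_ext F q"
  using linear_ext_add[of F "p - q" q] by (simp add: eq_diff_eq)

lemma linear_ext_sum [simp]: "linear_ext F (\<Sum>i\<in>I. g i) = (\<Sum>i\<in>I. linear_ext F (g i))"
  by (induction I rule: infinite_finite_induct) simp_all

lemma linear_ext_basis [simp]: "linear_ext F (basis_vec t) = F t"
  by (simp add: linear_ext_def)

lemma linear_ext_cong:
  "(\<And>t. t \<in> Poly_Mapping.keys p \<Longrightarrow> F t = G t) \<Longrightarrow> linear_ext F p = linear_ext G p"
  by (simp add: linear_ext_def)

lemma linear_ext_basis_id [simp]: "linear_ext basis_vec p = p"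
  by (rule poly_mapping_eqI)
    (simp add: linear_ext_def lookup_sum lookup_scale lookup_single when_def in_keys_iff
      if_distrib[of "(*) c" for c] cong: if_cong)

lemma linear_ext_zero_fun [simp]: "linear_ext (\<lambda>t. 0) p = 0"
  by (simp add: linear_ext_def)

lemma linear_ext_add_fun: "linear_ext (\<lambda>t. F t + G t) p = linear_ext F p + linear_ext G p"
  by (simp add: linear_ext_def fs.scale_right_distrib sum.distrib)

lemma linear_ext_scale_fun: "linear_ext (\<lambda>t. scale c (F t)) p = scale c (linear_ext F p)"
  by (simp add: linear_ext_def fs.scale_sum_right mult.commute)

lemma linear_ext_linear_ext:
  "linear_ext G (linear_ext F p) = linear_ext (\<lambda>t. linear_ext G (F t)) p"
  by (simp add: linear_ext_def[of F p] linear_ext_def[of "\<lambda>t. linear_ext G (F t)" p])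

lemma linear_ext_swap:
  "linear_ext (\<lambda>s. linear_ext (F s) q) p = linear_ext (\<lambda>t. linear_ext (\<lambda>s. F s t) p) q"
  unfolding linear_ext_def fs.scale_sum_right
  by (subst sum.swap) (simp add: mult.commute)

interpretation fsp: vector_space_pair
  "scale :: 'k::field \<Rightarrow> ('a \<Rightarrow>\<^sub>0 'k) \<Rightarrow> ('a \<Rightarrow>\<^sub>0 'k)"
  "scale :: 'k::field \<Rightarrow> ('b \<Rightarrow>\<^sub>0 'k) \<Rightarrow> ('b \<Rightarrow>\<^sub>0 'k)"
  by unfold_locales

lemma linear_ext_span:
  assumes "\<And>g. g \<in> G \<Longrightarrow> linear_ext F g \<in> S" "fs.subspace S" "p \<in> fs.span G"
  shows "linear_ext F p \<in> S"
  using assms(3)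
proof (induction rule: fs.span_induct_alt)
  case base
  then show ?case
    using assms(2) by (simp add: fs.subspace_0)
next
  case (step c x y)
  then show ?case
    using assms by (simp add: fs.subspace_add fs.subspace_scale)
qed

lemma linear_ext_in_subspace:
  assumes "fs.subspace S" "\<And>t. t \<in> Poly_Mapping.keys p \<Longrightarrow> F t \<in> S"
  shows "linear_ext F p \<in> S"
  unfolding linear_ext_def using assms by (auto intro!: fs.subspace_sum fs.subspace_scale)

text \<open>Both \<open>prod_expr\<close> and the multiplication of the truncated algebra are built
  from products of basis elements in this way, so distributivity and compatibility with scalars are
  proved once for both.\<close>

definition bilinear_ext ::
    "('a \<Rightarrow> 'b \<Rightarrow> ('c \<Rightarrow>\<^sub>0 'k::field)) \<Rightarrow> ('a \<Rightarrow>\<^sub>0 'k) \<Rightarrow> ('b \<Rightarrow>\<^sub>0 'k) \<Rightarrow> ('c \<Rightarrow>\<^sub>0 'k)" where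
  "bilinear_ext B p q = linear_ext (\<lambda>s. linear_ext (B s) q) p"

lemma bilinear_ext_swap: "bilinear_ext B p q = bilinear_ext (\<lambda>t s. B s t) q p"
  unfolding bilinear_ext_def by (rule linear_ext_swap)

lemma bilinear_ext_basis [simp]: "bilinear_ext B (basis_vec s) (basis_vec t) = B s t"
  by (simp add: bilinear_ext_def)

lemma bilinear_ext_simps [simp]:
  "bilinear_ext B (p + p') q = bilinear_ext B p q + bilinear_ext B p' q"
  "bilinear_ext B p (q + q') = bilinear_ext B p q + bilinear_ext B p q'"
  "bilinear_ext B (scale c p) q = scale c (bilinear_ext B p q)"
  "bilinear_ext B p (scale c q) = scale c (bilinear_ext B p q)"
  by (simp_all add: bilinear_ext_def linear_ext_add_fun linear_ext_scale_fun)

lemma bilinear_ext_linear_ext_left: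
  "bilinear_ext B (linear_ext F u) q = linear_ext (\<lambda>x. bilinear_ext B (F x) q) u"
  by (simp add: bilinear_ext_def linear_ext_linear_ext)

lemma bilinear_ext_linear_ext_right:
  "bilinear_ext B p (linear_ext F u) = linear_ext (\<lambda>x. bilinear_ext B p (F x)) u"
  by (subst (1 2) bilinear_ext_swap) (rule bilinear_ext_linear_ext_left)

lemma prod_expr_bilinear_ext:
  "prod_expr j = bilinear_ext (\<lambda>s t. mon_expr (Op j s t))"
  by (simp add: fun_eq_iff prod_expr_def bilinear_ext_def linear_ext_def fs.scale_sum_right)


section \<open>Multilinear monomials and symmetries\<close>

lemma subspace_multilinear: "fs.subspace (multilinear n :: ('j, 'k::field) expr set)"
proof (rule fs.subspaceI)
  show "p + q \<in> multilinear n" if "p \<in> multilinear n" "q \<in> multilinear n"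
    for p q :: "('j, 'k) expr"
    using that Poly_Mapping.keys_add[of p q] unfolding multilinear_def by blast
qed (auto simp: multilinear_def in_keys_iff lookup_scale subset_iff)

lemma mon_expr_multilinear [simp]: "mon_expr t \<in> multilinear n \<longleftrightarrow> t \<in> multilinear_mons n"
  by (simp add: multilinear_def)

lemma leaves_nonempty [simp]: "leaves t \<noteq> []"
  by (induction t) simp_all

lemma leaves_singleton: "length (leaves t) = 1 \<longleftrightarrow> (\<exists>n. t = Letter n)"
proof (cases t)
  case (Op j s u)
  moreover have "length (leaves s) > 0" "length (leaves u) > 0"
    by simp_all
  ultimately show ?thesis
    by (simp del: length_greater_0_conv)
qed simp

lemma length_leaves_multilinear: "t \<in> multilinear_mons n \<Longrightarrow> length (leaves t) = n"
  using distinct_card[of "leaves t"] by (simp add: multilinear_mons_def)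

text \<open>A binary tree with three leaves has a single leaf below the root on one side and a pair
  on the other. Both shapes occur because monomials are not reduced modulo the symmetries.\<close>

lemma multilinear_mons_3_cases:
  assumes "t \<in> multilinear_mons 3"
  obtains (left) i j a b c where "t = Op i (Op j (Letter a) (Letter b)) (Letter c)"
      "distinct [a, b, c]" "{a, b, c} = {1..3}"
  | (right) i j a b c where "t = Op i (Letter c) (Op j (Letter a) (Letter b))"
      "distinct [a, b, c]" "{a, b, c} = {1..3}"
proof -
  have len: "length (leaves t) = 3"
    using assms by (rule length_leaves_multilinear)
  then obtain i s u where t: "t = Op i s u"
    by (cases t) auto
  have pos: "length (leaves v) \<ge> 1" for v :: "'a mon"
    by (simp add: Suc_le_eq)
  have two: "\<exists>j a b. v = Op j (Letter a) (Letter b)" if "length (leaves v) = 2" for v :: "'a mon"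
  proof (cases v)
    case (Op j p q)
    then have "length (leaves p) = 1" "length (leaves q) = 1"
      using that pos[of p] pos[of q] by auto
    then show ?thesis
      using Op by (auto simp only: leaves_singleton)
  qed (use that in auto)
  consider "length (leaves s) = 2" "length (leaves u) = 1"
    | "length (leaves s) = 1" "length (leaves u) = 2"
    using len pos[of s] pos[of u] t by fastforce
  then show thesis
  proof cases
    case 1
    then obtain j a b c where "s = Op j (Letter a) (Letter b)" "u = Letter c"
      using two leaves_singleton by metis
    with t show thesis
      using assms by (intro left[of i j a b c]) (auto simp: multilinear_mons_def)
  next
    case 2
    then obtain j a b c where "u = Op j (Letter a) (Letter b)" "s = Letter c"
      using two leaves_singleton by metis
    with t show thesis
      using assms by (intro right[of i c j a b]) (auto simp: multilinear_mons_def)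
  qed
qed

lemma opp_step_leaves:
  "opp_step \<sigma> \<epsilon> t c t' \<Longrightarrow> set (leaves t') = set (leaves t) \<and> (distinct (leaves t') \<longleftrightarrow> distinct (leaves t))"
  by (induction rule: opp_step.induct) auto

lemma opp_step_multilinear:
  "opp_step \<sigma> \<epsilon> t c t' \<Longrightarrow> t' \<in> multilinear_mons n \<longleftrightarrow> t \<in> multilinear_mons n"
  by (simp add: multilinear_mons_def opp_step_leaves)

lemma symmetries_multilinear: "symmetries \<sigma> \<epsilon> n \<subseteq> multilinear n"
  unfolding symmetries_def
  by (intro fs.span_minimal subspace_multilinear)
    (auto intro!: fs.subspace_diff[OF subspace_multilinear] fs.subspace_scale[OF subspace_multilinear]
      simp: opp_step_multilinear)

lemma subspace_symmetries: "fs.subspace (symmetries \<sigma> \<epsilon> n)"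
  unfolding symmetries_def by (rule fs.subspace_span)

text \<open>A map of monomials that carries symmetry steps to symmetry steps with the same
  coefficient sends generators to generators. It is applied to renaming of letters and to removal of
  the superscripts.\<close>

lemma symmetries_linear_ext:
  assumes "\<And>t c t'. t \<in> multilinear_mons n \<Longrightarrow> opp_step \<sigma> \<epsilon> t c t' \<Longrightarrow>
      G t \<in> multilinear_mons n \<and> opp_step \<sigma>' \<epsilon>' (G t) c (G t')"
    and "s \<in> symmetries \<sigma> \<epsilon> n"
  shows "linear_ext (\<lambda>t. mon_expr (G t)) s \<in> symmetries \<sigma>' \<epsilon>' n"
  using assms(2) unfolding symmetries_def[of \<sigma>]
proof (rule linear_ext_span[rotated 2])
  fix g :: "('a, 'b) expr"
  assume "g \<in> {mon_expr t - scale c (mon_expr t') | t c t'. t \<in> multilinear_mons n \<and> opp_step \<sigma> \<epsilon> t c t'}"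
  then show "linear_ext (\<lambda>t. mon_expr (G t)) g \<in> symmetries \<sigma>' \<epsilon>' n"
    using assms(1) unfolding symmetries_def by (force intro!: fs.span_base)
qed (rule subspace_symmetries)

lemma opp_step_rename:
  "opp_step \<sigma> \<epsilon> t c t' \<Longrightarrow> opp_step \<sigma> \<epsilon> (rename_mon \<pi> t) c (rename_mon \<pi> t')"
  by (induction rule: opp_step.induct) (auto intro: opp_step.intros)

lemma leaves_rename: "leaves (rename_mon \<pi> t) = map \<pi> (leaves t)"
  by (induction t) simp_all

lemma rename_multilinear_mons:
  "\<pi> permutes {1..n} \<Longrightarrow> t \<in> multilinear_mons n \<Longrightarrow> rename_mon \<pi> t \<in> multilinear_mons n"
  by (auto simp: multilinear_mons_def leaves_rename distinct_map permutes_image intro: permutes_inj_on)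

lemma rename_symmetries:
  "\<pi> permutes {1..n} \<Longrightarrow> s \<in> symmetries \<sigma> \<epsilon> n \<Longrightarrow> rename \<pi> s \<in> symmetries \<sigma> \<epsilon> n"
  unfolding rename_def
  by (rule symmetries_linear_ext) (simp_all add: rename_multilinear_mons opp_step_rename)


section \<open>Identities\<close>

lemma eval_mon_in_algebra:
  "algebra \<sigma> \<epsilon> A m \<Longrightarrow> range a \<subseteq> A \<Longrightarrow> eval_mon m a t \<in> A"
proof (induction t)
  case (Op j s t)
  then show ?case
    unfolding algebra_def eval_mon.simps by blast
qed auto

lemma eval_mon_opp_step:
  assumes "algebra \<sigma> \<epsilon> A m" "range a \<subseteq> A" "opp_step \<sigma> \<epsilon> t c t'"
  shows "eval_mon m a t = scale c (eval_mon m a t')"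
  using assms(3)
proof (induction rule: opp_step.induct)
  case (root j s t)
  then show ?case
    using assms(1) eval_mon_in_algebra[OF assms(1,2)] unfolding algebra_def eval_mon.simps by blast
next
  case (left s c s' j t)
  then show ?case
    using assms(1) eval_mon_in_algebra[OF assms(1,2)] unfolding algebra_def eval_mon.simps by metis
next
  case (right t c t' j s)
  then show ?case
    using assms(1) eval_mon_in_algebra[OF assms(1,2)] unfolding algebra_def eval_mon.simps by metis
qed

text \<open>Evaluation is linear, and by \<open>eval_mon_opp_step\<close> it kills the generators of
  the symmetries on every algebra.\<close>

lemma satisfies_span_symmetries:
  assumes "algebra \<sigma> \<epsilon> A m" "\<And>g. g \<in> G \<Longrightarrow> satisfies A m g"
    and "p \<in> fs.span (G \<union> symmetries \<sigma> \<epsilon> n)"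
  shows "satisfies A m p"
  unfolding satisfies_def
proof (intro allI impI)
  fix a :: "nat \<Rightarrow> _"
  assume a: "range a \<subseteq> A"
  let ?F = "linear_ext (eval_mon m a)"
  have zero: "fs.subspace {0}"
    by (rule fs.subspace_single_0)
  have "?F s \<in> {0}" if "s \<in> symmetries \<sigma> \<epsilon> n" for s
    using that unfolding symmetries_def
    by (rule linear_ext_span[OF _ zero, rotated])
      (auto simp: eval_mon_opp_step[OF assms(1) a])
  then have "?F p \<in> {0}"
    using assms(2) a by (intro linear_ext_span[OF _ zero assms(3)]) (auto simp: satisfies_def)
  then show "?F p = 0"
    by simp
qed

text \<open>Passes from the generating set \<open>pre_axioms R\<close> to a subspace containing the
  symmetries, the form in which the degree 3 identities are computed below.\<close>

lemma identities_span_symmetries: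
  fixes X :: "'x itself"
  shows "identities X \<sigma> \<epsilon> (fs.span (G \<union> symmetries \<sigma> \<epsilon> n)) = identities X \<sigma> \<epsilon> G"
proof -
  have "(\<forall>g\<in>fs.span (G \<union> symmetries \<sigma> \<epsilon> n). satisfies A m g) \<longleftrightarrow> (\<forall>g\<in>G. satisfies A m g)"
    if "algebra \<sigma> \<epsilon> A m" for A :: "('x \<Rightarrow>\<^sub>0 'b) set" and m
    using satisfies_span_symmetries[OF that] by (meson UnI1 fs.span_base)
  then show ?thesis
    unfolding identities_def by blast
qed


section \<open>The truncated free algebra\<close>

lemma leaves_subst: "leaves (eval_mon Op u t) = concat (map (leaves \<circ> u) (leaves t))"
  by (induction t) simp_all

lemma rename_mon_subst: "rename_mon \<pi> t = eval_mon Op (Letter \<circ> \<pi>) t"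
  by (induction t) simp_all

lemma eval_mon_cong:
  "(\<And>n. n \<in> set (leaves t) \<Longrightarrow> a n = b n) \<Longrightarrow> eval_mon m a t = eval_mon m b t"
  by (induction t) simp_all

text \<open>Each of the three substituted monomials has at least one leaf and together they have
  three, so each is a letter. Multilinearity of the result makes these letters a
  permutation.\<close>

lemma subst_multilinear_mons_3:
  assumes t: "t \<in> multilinear_mons 3" and st: "eval_mon Op u t \<in> multilinear_mons 3"
  shows "\<exists>\<pi>. \<pi> permutes {1..3} \<and> (\<forall>n\<in>{1..3}. u n = Letter (\<pi> n))"
proof -
  have len: "length (leaves (u n)) \<ge> 1" for n
    by (simp add: Suc_le_eq)
  have "sum_list (map (length \<circ> leaves \<circ> u) (leaves t)) = 3"
    using length_leaves_multilinear[OF st] by (simp add: leaves_subst length_concat comp_assoc)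
  then have sum: "(\<Sum>n\<in>{1..3}. length (leaves (u n))) = 3"
    using t by (simp add: multilinear_mons_def sum_list_distinct_conv_sum_set)
  have "length (leaves (u n)) = 1" if "n \<in> {1..3}" for n
  proof (rule ccontr)
    assume "length (leaves (u n)) \<noteq> 1"
    then have "1 < length (leaves (u n))"
      using len[of n] by simp
    then have "(\<Sum>n\<in>{1..3::nat}. 1) < (\<Sum>n\<in>{1..3}. length (leaves (u n)))"
      using that len by (intro sum_strict_mono_ex1) auto
    then show False
      using sum by simp
  qed
  then have "\<forall>n\<in>{1..3}. \<exists>k. u n = Letter k"
    using leaves_singleton by blast
  then obtain b where b: "\<And>n. n \<in> {1..3} \<Longrightarrow> u n = Letter (b n)"
    by metis
  \<comment> \<open>Extension by the identity, as \<open>permutes\<close> demands; only the letters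
    1, 2, 3 occur in \<open>t\<close>.\<close>
  define \<pi> where "\<pi> n = (if n \<in> {1..3} then b n else n)" for n
  have "eval_mon Op u t = eval_mon Op (Letter \<circ> \<pi>) t"
    using t b by (intro eval_mon_cong) (auto simp: multilinear_mons_def \<pi>_def)
  then have "leaves (eval_mon Op u t) = map \<pi> (leaves t)"
    by (metis rename_mon_subst leaves_rename)
  then have "inj_on \<pi> {1..3}" "\<pi> ` {1..3} = {1..3}"
    using t st by (auto simp: multilinear_mons_def distinct_map)
  then have "\<pi> permutes {1..3}"
    by (intro bij_imp_permutes) (auto simp: bij_betw_def \<pi>_def)
  then show ?thesis
    using b by (intro exI[of _ \<pi>]) (auto simp: \<pi>_def)
qed

text \<open>
  A linear functional \<open>\<phi>\<close> on arity 3 that respects the symmetries defines an algebra, nilpotent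
  of class 4: the product of two letters is the symmetrised monomial, so no quotient by the
  symmetries is needed, and all further products are read off from \<open>\<phi>\<close> as multiples of a single
  element \<open>z\<close>. The letter \<open>x\<^sub>0\<close> is not among \<open>x\<^sub>1, x\<^sub>2, x\<^sub>3\<close>, which makes \<open>z\<close> annihilate everything.
  An \<open>x\<close> outside the range of \<open>embed\<close> just behaves like some monomial.
\<close>

locale truncation =
  fixes \<sigma> :: "'j \<Rightarrow> 'j" and \<epsilon> :: "'j \<Rightarrow> 'k::field_char_0" and \<phi> :: "'j mon \<Rightarrow> 'k"
    and embed :: "'j mon \<Rightarrow> 'x"
  assumes opposite_data: "opposite_data \<sigma> \<epsilon>"
    and inj_embed: "inj embed"
    and \<phi>_outside: "t \<notin> multilinear_mons 3 \<Longrightarrow> \<phi> t = 0"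
    and \<phi>_opp_step: "t \<in> multilinear_mons 3 \<Longrightarrow> opp_step \<sigma> \<epsilon> t c t' \<Longrightarrow> \<phi> t = c * \<phi> t'"
begin

definition z :: "'j mon" where
  "z = Op undefined (Letter 0) (Letter 0)"

definition mon_prod :: "'j \<Rightarrow> 'j mon \<Rightarrow> 'j mon \<Rightarrow> ('x \<Rightarrow>\<^sub>0 'k)" where
  "mon_prod j s t =
    (if (\<exists>a. s = Letter a) \<and> (\<exists>b. t = Letter b)
     then basis_vec (embed (Op j s t)) + scale (\<epsilon> j) (basis_vec (embed (Op (\<sigma> j) t s)))
     else scale (\<phi> (Op j s t)) (basis_vec (embed z)))"

definition trunc_op :: "'j \<Rightarrow> ('x \<Rightarrow>\<^sub>0 'k) \<Rightarrow> ('x \<Rightarrow>\<^sub>0 'k) \<Rightarrow> ('x \<Rightarrow>\<^sub>0 'k)" where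
  "trunc_op j = bilinear_ext (\<lambda>x y. mon_prod j (inv embed x) (inv embed y))"

text \<open>A symmetry step preserves multilinearity, so outside \<open>multilinear_mons 3\<close>
  both sides vanish.\<close>

lemma \<phi>_opp: "opp_step \<sigma> \<epsilon> t c t' \<Longrightarrow> \<phi> t = c * \<phi> t'"
  using \<phi>_opp_step \<phi>_outside opp_step_multilinear mult_zero_right by metis

lemma \<epsilon>_square: "\<epsilon> j * \<epsilon> j = 1"
  using opposite_data unfolding opposite_data_def by (metis mult_1 mult_minus1 minus_minus)

text \<open>For two letters the swap exchanges the two summands, since \<sigma> is an involution and
  each sign squares to 1. Otherwise this is the compatibility of \<phi> with a symmetry at the
  root.\<close>

lemma mon_prod_opp: "mon_prod j t s = scale (\<epsilon> j) (mon_prod (\<sigma> j) s t)"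
proof (cases "(\<exists>a. s = Letter a) \<and> (\<exists>b. t = Letter b)")
  case True
  then show ?thesis
    using opposite_data
    by (auto simp: mon_prod_def opposite_data_def fs.scale_right_distrib \<epsilon>_square add.commute)
next
  case False
  then show ?thesis
    using \<phi>_opp[OF opp_step.root[of \<sigma> \<epsilon> j t s]] by (auto simp: mon_prod_def)
qed

lemma trunc_op_simps:
  "trunc_op j (p + p') q = trunc_op j p q + trunc_op j p' q"
  "trunc_op j p (q + q') = trunc_op j p q + trunc_op j p q'"
  "trunc_op j (scale c p) q = scale c (trunc_op j p q)"
  "trunc_op j p (scale c q) = scale c (trunc_op j p q)"
  by (simp_all add: trunc_op_def)

lemma algebra_trunc_op: "algebra \<sigma> \<epsilon> UNIV trunc_op"
proof -
  have "trunc_op j b a = scale (\<epsilon> j) (trunc_op (\<sigma> j) a b)" for j a b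
    unfolding trunc_op_def bilinear_ext_swap[of _ b a]
    by (subst mon_prod_opp) (simp add: bilinear_ext_def linear_ext_scale_fun)
  then show ?thesis
    unfolding algebra_def
    by (intro conjI allI ballI fs.subspace_UNIV UNIV_I trunc_op_simps)
qed

lemma trunc_op_embed [simp]:
  "trunc_op j (basis_vec (embed s)) (basis_vec y) = mon_prod j s (inv embed y)"
  by (simp add: trunc_op_def inj_embed)

lemma trunc_op_linear_ext:
  "trunc_op j (linear_ext F u) q = linear_ext (\<lambda>x. trunc_op j (F x) q) u"
  "trunc_op j p (linear_ext F u) = linear_ext (\<lambda>x. trunc_op j p (F x)) u"
  by (simp_all add: trunc_op_def bilinear_ext_linear_ext_left bilinear_ext_linear_ext_right)

lemma \<phi>_z [simp]: "\<phi> (Op j z t) = 0"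
  by (auto intro!: \<phi>_outside simp: z_def multilinear_mons_def)

lemma mon_prod_z [simp]: "mon_prod j z t = 0"
proof -
  have "\<nexists>a. z = Letter a"
    by (simp add: z_def)
  then show ?thesis
    by (simp add: mon_prod_def)
qed

lemma \<phi>_subst_nonletter:
  assumes "t \<in> multilinear_mons 3" "n \<in> {1..3}" "\<nexists>k. u n = Letter k"
  shows "\<phi> (eval_mon Op u t) = 0"
  using subst_multilinear_mons_3[OF assms(1), of u] assms(2,3) by (blast intro: \<phi>_outside)

text \<open>The factor 2 appears because the inner product of two letters is a sum of two monomials
  related by a symmetry, and \<phi> gives both the same contribution.\<close>

lemma eval_mon_basis:
  assumes t: "t \<in> multilinear_mons 3"
  shows "eval_mon trunc_op (\<lambda>n. basis_vec (x n)) t =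
    scale (2 * \<phi> (eval_mon Op (inv embed \<circ> x) t)) (basis_vec (embed z))"
proof -
  let ?e = "eval_mon trunc_op (\<lambda>n. basis_vec (x n))" and ?u = "inv embed \<circ> x"
  have op: "trunc_op j (basis_vec (x a)) (basis_vec (x b)) = mon_prod j (?u a) (?u b)" for j a b
    by (simp add: trunc_op_def)
  have left: "?e t = scale (2 * \<phi> (eval_mon Op ?u t)) (basis_vec (embed z))"
    if t: "t \<in> multilinear_mons 3" "t = Op i (Op j (Letter a) (Letter b)) (Letter c)" for t i j a b c
  proof (cases "(\<exists>k. ?u a = Letter k) \<and> (\<exists>k. ?u b = Letter k)")
    case True
    then have "?e t = scale (\<phi> (Op i (Op j (?u a) (?u b)) (?u c))) (basis_vec (embed z)) +
        scale (\<epsilon> j * \<phi> (Op i (Op (\<sigma> j) (?u b) (?u a)) (?u c))) (basis_vec (embed z))"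
      by (simp only: t eval_mon.simps op) (auto simp: mon_prod_def trunc_op_simps)
    then show ?thesis
      using \<phi>_opp[OF opp_step.left[OF opp_step.root], of i j "?u a" "?u b" "?u c"]
      by (simp add: t flip: fs.scale_left_distrib)
  next
    \<comment> \<open>Now the inner product is a multiple of \<open>z\<close>, which annihilates
      everything, while \<phi> vanishes because a non-letter was substituted.\<close>
    case False
    have "a \<in> {1..3}" "b \<in> {1..3}"
      using t by (auto simp: multilinear_mons_def)
    with False have "\<phi> (eval_mon Op ?u t) = 0"
      using \<phi>_subst_nonletter[OF t(1), of _ ?u] by blast
    moreover have "?e t = 0"
      using False by (simp only: t eval_mon.simps op) (auto simp: mon_prod_def[of j] trunc_op_simps)
    ultimately show ?thesis
      by simp
  qed
  from t show ?thesis
  proof (cases rule: multilinear_mons_3_cases)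
    \<comment> \<open>A symmetry at the root reduces this shape to the other one; evaluation and
      \<phi> pick up the same sign.\<close>
    case (right i j a b c)
    let ?t' = "Op (\<sigma> i) (Op j (Letter a) (Letter b)) (Letter c)"
    have step: "opp_step \<sigma> \<epsilon> t (\<epsilon> i) ?t'" "opp_step \<sigma> \<epsilon> (eval_mon Op ?u t) (\<epsilon> i) (eval_mon Op ?u ?t')"
      by (simp_all only: right eval_mon.simps opp_step.root)
    have "?t' \<in> multilinear_mons 3"
      using t opp_step_multilinear[OF step(1)] by blast
    then have "?e ?t' = scale (2 * \<phi> (eval_mon Op ?u ?t')) (basis_vec (embed z))"
      by (rule left) simp
    moreover have "?e t = scale (\<epsilon> i) (?e ?t')"
      by (rule eval_mon_opp_step[OF algebra_trunc_op subset_UNIV step(1)])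
    moreover have "\<phi> (eval_mon Op ?u t) = \<epsilon> i * \<phi> (eval_mon Op ?u ?t')"
      by (rule \<phi>_opp[OF step(2)])
    ultimately show ?thesis
      by (simp only: fs.scale_scale mult.left_commute)
  qed (use left t in blast)
qed

text \<open>A letter occurring exactly once enters the value linearly: at each node it lies in one
  factor, and the other factor does not depend on it.\<close>

lemma eval_mon_expand:
  assumes "distinct (leaves t)" "k \<in> set (leaves t)"
  shows "eval_mon trunc_op (a(k := v)) t = linear_ext (\<lambda>x. eval_mon trunc_op (a(k := basis_vec x)) t) v"
  using assms
proof (induction t)
  case (Op j s t)
  have irrelevant: "eval_mon trunc_op (a(k := w)) r = eval_mon trunc_op a r"
    if "k \<notin> set (leaves r)" for w and r :: "'j mon"
    using that by (intro eval_mon_cong) auto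
  show ?case
  proof (cases "k \<in> set (leaves s)")
    case True
    with Op.prems have "k \<notin> set (leaves t)"
      by auto
    with True Op show ?thesis
      by (simp add: trunc_op_linear_ext irrelevant[unfolded fun_upd_def] fun_upd_def)
  next
    case False
    with Op show ?thesis
      by (simp add: trunc_op_linear_ext irrelevant[unfolded fun_upd_def] fun_upd_def)
  qed
qed simp

text \<open>On basis elements, either the substitution permutes the letters 1, 2, 3, or \<phi>
  vanishes on all resulting monomials. Linearity in each letter extends this to arbitrary
  elements.\<close>

lemma satisfies_if_\<phi>:
  assumes q: "q \<in> multilinear 3"
    and \<phi>: "\<And>\<pi>. \<pi> permutes {1..3} \<Longrightarrow>
      (\<Sum>t\<in>Poly_Mapping.keys q. Poly_Mapping.lookup q t * \<phi> (rename_mon \<pi> t)) = 0"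
  shows "satisfies UNIV trunc_op q"
  unfolding satisfies_def
proof (intro allI impI)
  fix a :: "nat \<Rightarrow> ('x \<Rightarrow>\<^sub>0 'k)"
  let ?F = "\<lambda>a. linear_ext (eval_mon trunc_op a) q"
  have mon: "t \<in> multilinear_mons 3" if "t \<in> Poly_Mapping.keys q" for t
    using q that by (auto simp: multilinear_def)
  have basis: "?F (\<lambda>n. basis_vec (x n)) = 0" for x
  proof -
    let ?u = "inv embed \<circ> x"
    have "(\<Sum>t\<in>Poly_Mapping.keys q. Poly_Mapping.lookup q t * \<phi> (eval_mon Op ?u t)) = 0"
    proof (cases "\<exists>\<pi>. \<pi> permutes {1..3} \<and> (\<forall>n\<in>{1..3}. ?u n = Letter (\<pi> n))")
      case True
      then obtain \<pi> where \<pi>: "\<pi> permutes {1..3}" "\<And>n. n \<in> {1..3} \<Longrightarrow> ?u n = Letter (\<pi> n)"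
        by blast
      have "eval_mon Op ?u t = rename_mon \<pi> t" if "t \<in> Poly_Mapping.keys q" for t
        unfolding rename_mon_subst using mon[OF that] \<pi>(2)
        by (intro eval_mon_cong) (auto simp: multilinear_mons_def)
      then show ?thesis
        using \<phi>[OF \<pi>(1)] by simp
    next
      case False
      then have "\<phi> (eval_mon Op ?u t) = 0" if "t \<in> Poly_Mapping.keys q" for t
        using mon[OF that] subst_multilinear_mons_3 \<phi>_outside by blast
      then show ?thesis
        by simp
    qed
    then have "(\<Sum>t\<in>Poly_Mapping.keys q. Poly_Mapping.lookup q t * (2 * \<phi> (eval_mon Op ?u t))) = 0"
      by (simp add: mult.left_commute flip: sum_distrib_left)
    then show ?thesis
      using mon by (simp add: linear_ext_def eval_mon_basis flip: fs.scale_sum_left)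
  qed
  \<comment> \<open>Frees one letter at a time from the restriction to basis elements.\<close>
  have step: "?F a = 0" if k: "k \<in> {1..3}" and 0: "\<And>x. ?F (a(k := basis_vec x)) = 0" for k a
  proof -
    have "?F a = ?F (a(k := a k))"
      by simp
    also have "\<dots> = linear_ext (\<lambda>t. linear_ext (\<lambda>x. eval_mon trunc_op (a(k := basis_vec x)) t) (a k)) q"
      using k mon by (intro linear_ext_cong eval_mon_expand) (auto simp: multilinear_mons_def)
    also have "\<dots> = linear_ext (\<lambda>x. ?F (a(k := basis_vec x))) (a k)"
      by (rule linear_ext_swap)
    finally show ?thesis
      using 0 by simp
  qed
  \<comment> \<open>Other letters do not occur in \<open>q\<close>, so their values may be replaced
    by basis elements too; \<open>x3\<close> is an arbitrary choice.\<close>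
  have "?F (a(1 := basis_vec x1, 2 := basis_vec x2, 3 := basis_vec x3)) = 0" for x1 x2 x3
  proof -
    have "?F (a(1 := basis_vec x1, 2 := basis_vec x2, 3 := basis_vec x3)) =
        ?F (\<lambda>n. basis_vec (if n = 1 then x1 else if n = 2 then x2 else x3))"
    proof (intro linear_ext_cong eval_mon_cong)
      fix t n
      assume "t \<in> Poly_Mapping.keys q" "n \<in> set (leaves t)"
      then have "n \<in> {1..3}"
        using mon by (auto simp: multilinear_mons_def)
      then have "n = 1 \<or> n = 2 \<or> n = 3"
        by auto
      then show "(a(1 := basis_vec x1, 2 := basis_vec x2, 3 := basis_vec x3)) n =
          basis_vec (if n = 1 then x1 else if n = 2 then x2 else x3)"
        by auto
    qed
    then show ?thesis
      by (simp only: basis)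
  qed
  then have "?F (a(1 := basis_vec x1, 2 := basis_vec x2)) = 0" for x1 x2
    by (intro step[of 3 "a(1 := basis_vec x1, 2 := basis_vec x2)"]) simp_all
  then have "?F (a(1 := basis_vec x1)) = 0" for x1
    by (intro step[of 2 "a(1 := basis_vec x1)"]) simp_all
  then show "?F a = 0"
    by (intro step[of 1 a]) simp_all
qed

text \<open>Substituting the generators themselves returns twice the value of the functional as the
  coefficient of \<open>z\<close>; in characteristic 0 the factor 2 cancels.\<close>

lemma \<phi>_if_satisfies:
  assumes "q \<in> multilinear 3" "satisfies UNIV trunc_op q"
  shows "(\<Sum>t\<in>Poly_Mapping.keys q. Poly_Mapping.lookup q t * \<phi> t) = 0"
proof -
  have "eval_mon trunc_op (\<lambda>n. basis_vec (embed (Letter n))) t =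
      scale (2 * \<phi> t) (basis_vec (embed z))" if "t \<in> Poly_Mapping.keys q" for t
  proof -
    have "eval_mon Op Letter s = s" for s :: "'j mon"
      by (induction s) simp_all
    moreover have "inv embed \<circ> (\<lambda>n. embed (Letter n)) = Letter"
      by (simp add: fun_eq_iff inj_embed)
    ultimately show ?thesis
      using eval_mon_basis[of t "\<lambda>n. embed (Letter n)"] assms(1) that
      by (auto simp: multilinear_def)
  qed
  moreover have "linear_ext (eval_mon trunc_op (\<lambda>n. basis_vec (embed (Letter n)))) q = 0"
    using assms(2) by (simp add: satisfies_def)
  ultimately have "scale (\<Sum>t\<in>Poly_Mapping.keys q. Poly_Mapping.lookup q t * (2 * \<phi> t)) (basis_vec (embed z)) = 0"
    by (simp add: linear_ext_def fs.scale_sum_left)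
  then have "(\<Sum>t\<in>Poly_Mapping.keys q. Poly_Mapping.lookup q t * (2 * \<phi> t)) = 0"
    by (metis fs.scale_eq_0_iff single_zero lookup_single_eq lookup_zero zero_neq_one)
  then show ?thesis
    by (simp add: mult.left_commute flip: sum_distrib_left)
qed

end

section \<open>Degree 3 identities of a quadratic variety\<close>

lemma separating_functional:
  fixes p :: "'a \<Rightarrow>\<^sub>0 'k::field"
  assumes "fs.subspace Q" "p \<notin> Q"
  obtains \<phi> :: "'a \<Rightarrow> 'k" where
    "\<And>q. q \<in> Q \<Longrightarrow> (\<Sum>t\<in>Poly_Mapping.keys q. Poly_Mapping.lookup q t * \<phi> t) = 0"
    "(\<Sum>t\<in>Poly_Mapping.keys p. Poly_Mapping.lookup p t * \<phi> t) \<noteq> 0"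
proof -
  obtain B where B: "B \<subseteq> Q" "fs.independent B" "Q \<subseteq> fs.span B"
    using fs.maximal_independent_subset by blast
  have "fs.span B = Q"
    using B assms(1) fs.span_minimal by blast
  then have "fs.independent (insert p B)"
    using B(2) assms(2) by (intro fs.independent_insertI) auto
  \<comment> \<open>The linear map \<open>g\<close> fixes \<open>p\<close> and kills a basis of
    \<open>Q\<close>. The functional is its coordinate at a point \<open>y\<close> of the support of
    \<open>p\<close>.\<close>
  then obtain g :: "('a \<Rightarrow>\<^sub>0 'k) \<Rightarrow> ('a \<Rightarrow>\<^sub>0 'k)" where g: "Vector_Spaces.linear scale scale g"
    and gB: "\<And>x. x \<in> insert p B \<Longrightarrow> g x = (if x = p then p else 0)"
    using fsp.linear_independent_extend[of "insert p B" "\<lambda>x. if x = p then p else 0"] by metis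
  have "p \<noteq> 0"
    using assms fs.subspace_0 by blast
  then obtain y where y: "Poly_Mapping.lookup p y \<noteq> 0"
    by (metis poly_mapping_eqI lookup_zero)
  have g_expand: "(\<Sum>t\<in>Poly_Mapping.keys q. Poly_Mapping.lookup q t * Poly_Mapping.lookup (g (basis_vec t)) y)
      = Poly_Mapping.lookup (g q) y" for q
  proof -
    have "g q = g (linear_ext basis_vec q)"
      by simp
    also have "\<dots> = (\<Sum>t\<in>Poly_Mapping.keys q. scale (Poly_Mapping.lookup q t) (g (basis_vec t)))"
      unfolding linear_ext_def by (simp add: fsp.linear_sum[OF g] fsp.linear_scale[OF g])
    finally show ?thesis
      by (simp add: lookup_sum lookup_scale)
  qed
  show thesis
  proof (rule that[of "\<lambda>t. Poly_Mapping.lookup (g (basis_vec t)) y"])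
    fix q
    assume "q \<in> Q"
    then have "q \<in> fs.span B"
      using B(3) by blast
    moreover have "g x = 0" if "x \<in> B" for x
      using that gB[of x] B(1) assms(2) by auto
    ultimately have "g q = 0"
      using fsp.linear_eq_0_on_span[OF g] by blast
    then show "(\<Sum>t\<in>Poly_Mapping.keys q. Poly_Mapping.lookup q t * Poly_Mapping.lookup (g (basis_vec t)) y) = 0"
      by (simp add: g_expand)
  next
    show "(\<Sum>t\<in>Poly_Mapping.keys p. Poly_Mapping.lookup p t * Poly_Mapping.lookup (g (basis_vec t)) y) \<noteq> 0"
      using y gB by (simp add: g_expand)
  qed
qed

text \<open>Viewing scalars as vectors over the one-element basis \<open>()\<close> makes the
  linearity rules for \<open>linear_ext\<close> available for the functional.\<close>

lemma sum_lookup_mult_eq: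
  "(\<Sum>t\<in>Poly_Mapping.keys q. Poly_Mapping.lookup q t * \<phi> t) =
    Poly_Mapping.lookup (linear_ext (\<lambda>t. Poly_Mapping.single () (\<phi> t)) q) ()"
  by (simp add: linear_ext_def lookup_sum lookup_scale)

text \<open>An identity \<open>p\<close> outside \<open>Q\<close> would be separated from
  \<open>Q\<close> by a functional. The truncated algebra of that functional satisfies
  \<open>Q\<close> but not \<open>p\<close>.\<close>

lemma identities_multilinear_3:
  fixes \<sigma> :: "'j \<Rightarrow> 'j" and \<epsilon> :: "'j \<Rightarrow> 'k::field_char_0" and embed :: "'j mon \<Rightarrow> 'x"
  assumes "opposite_data \<sigma> \<epsilon>" and Q: "quadratic_relations \<sigma> \<epsilon> Q" and "inj embed"
  shows "multilinear 3 \<inter> identities TYPE('x) \<sigma> \<epsilon> Q = Q"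
proof
  have Q_sub: "fs.subspace Q" "symmetries \<sigma> \<epsilon> 3 \<subseteq> Q" "Q \<subseteq> multilinear 3"
    and Q_rename: "\<And>\<pi> q. \<pi> permutes {1..3} \<Longrightarrow> q \<in> Q \<Longrightarrow> rename \<pi> q \<in> Q"
    using Q unfolding quadratic_relations_def by blast+
  show "Q \<subseteq> multilinear 3 \<inter> identities TYPE('x) \<sigma> \<epsilon> Q"
    using Q_sub(3) by (auto simp: identities_def)
  show "multilinear 3 \<inter> identities TYPE('x) \<sigma> \<epsilon> Q \<subseteq> Q"
  proof (rule ccontr)
    assume "\<not> ?thesis"
    then obtain p where p: "p \<in> multilinear 3" "p \<in> identities TYPE('x) \<sigma> \<epsilon> Q" "p \<notin> Q"
      by blast
    obtain \<psi> where \<psi>: "\<And>q. q \<in> Q \<Longrightarrow> (\<Sum>t\<in>Poly_Mapping.keys q. Poly_Mapping.lookup q t * \<psi> t) = 0"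
      "(\<Sum>t\<in>Poly_Mapping.keys p. Poly_Mapping.lookup p t * \<psi> t) \<noteq> 0"
      using separating_functional[OF Q_sub(1) p(3)] by blast
    \<comment> \<open>Cutting off outside the multilinear monomials meets the requirement of the
      locale and leaves the values on \<open>multilinear 3\<close> unchanged.\<close>
    define \<phi> where "\<phi> t = (if t \<in> multilinear_mons 3 then \<psi> t else 0)" for t
    have \<phi>_eq: "(\<Sum>t\<in>Poly_Mapping.keys q. Poly_Mapping.lookup q t * \<phi> t) =
        (\<Sum>t\<in>Poly_Mapping.keys q. Poly_Mapping.lookup q t * \<psi> t)" if "q \<in> multilinear 3" for q
      using that by (intro sum.cong) (auto simp: multilinear_def \<phi>_def)
    have \<phi>_Q: "(\<Sum>t\<in>Poly_Mapping.keys q. Poly_Mapping.lookup q t * \<phi> t) = 0" if "q \<in> Q" for q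
      using that \<psi>(1) \<phi>_eq Q_sub(3) by auto
    interpret truncation \<sigma> \<epsilon> \<phi> embed
    proof
      fix t c t'
      assume t: "t \<in> multilinear_mons 3" "opp_step \<sigma> \<epsilon> t c t'"
      then have "mon_expr t - scale c (mon_expr t') \<in> Q"
        using Q_sub(2) unfolding symmetries_def by (blast intro: fs.span_base)
      then have "(\<Sum>s\<in>Poly_Mapping.keys (mon_expr t - scale c (mon_expr t')).
          Poly_Mapping.lookup (mon_expr t - scale c (mon_expr t')) s * \<phi> s) = 0"
        by (rule \<phi>_Q)
      then show "\<phi> t = c * \<phi> t'"
        unfolding sum_lookup_mult_eq by (simp add: lookup_minus lookup_scale)
    qed (use assms in \<open>simp_all add: \<phi>_def\<close>)
    have "satisfies UNIV trunc_op q" if "q \<in> Q" for q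
    proof (rule satisfies_if_\<phi>)
      fix \<pi> :: "nat \<Rightarrow> nat"
      assume "\<pi> permutes {1..3}"
      \<comment> \<open>Stability of \<open>Q\<close> under permutations enters here: the sum is the
        value of the functional on \<open>rename \<pi> q\<close>.\<close>
      from \<phi>_Q[OF Q_rename[OF this that]]
      show "(\<Sum>t\<in>Poly_Mapping.keys q. Poly_Mapping.lookup q t * \<phi> (rename_mon \<pi> t)) = 0"
        unfolding sum_lookup_mult_eq by (simp add: rename_def linear_ext_linear_ext)
    qed (use that Q_sub(3) in auto)
    then have "satisfies UNIV trunc_op p"
      using p(2) algebra_trunc_op unfolding identities_def by blast
    then show False
      using \<phi>_if_satisfies[OF p(1)] \<phi>_eq[OF p(1)] \<psi>(2) by simp
  qed
qed



section \<open>Splitting\<close>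

lemma opposite_data_pre: "opposite_data \<sigma> \<epsilon> \<Longrightarrow> opposite_data (pre_opp \<sigma>) (pre_sign \<epsilon>)"
  by (auto simp: opposite_data_def pre_sign_def split: half.split)

lemma prod_expr_simps [simp]:
  "prod_expr j (mon_expr s) (mon_expr t) = mon_expr (Op j s t)"
  "prod_expr j (p + p') q = prod_expr j p q + prod_expr j p' q"
  "prod_expr j p (q + q') = prod_expr j p q + prod_expr j p q'"
  by (simp_all add: prod_expr_bilinear_ext)

lemma split_mon_multilinear:
  assumes "t \<in> multilinear_mons 3"
  shows "split_mon k t \<in> multilinear 3"
  using assms
  by (cases rule: multilinear_mons_3_cases)
    (auto intro!: fs.subspace_add[OF subspace_multilinear] simp: multilinear_mons_def)

lemma split_at_multilinear: "f \<in> multilinear 3 \<Longrightarrow> split_at k f \<in> multilinear 3"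
  unfolding split_at_def
  by (intro linear_ext_in_subspace subspace_multilinear split_mon_multilinear)
    (auto simp: multilinear_def)

text \<open>The path to the letter \<open>k\<close> decides the superscripts, and an injective
  renaming moves it to the path to \<open>\<pi> k\<close>.\<close>

lemma rename_split_mon:
  assumes "t \<in> multilinear_mons 3" "\<pi> permutes {1..3}"
  shows "rename \<pi> (split_mon k t) = split_mon (\<pi> k) (rename_mon \<pi> t)"
  using assms(1)
  by (cases rule: multilinear_mons_3_cases)
    (simp_all add: rename_def inj_eq[OF permutes_inj[OF assms(2)]])

lemma rename_split_at:
  assumes "f \<in> multilinear 3" "\<pi> permutes {1..3}"
  shows "rename \<pi> (split_at k f) = split_at (\<pi> k) (rename \<pi> f)"
proof -
  have "rename \<pi> (split_at k f) = linear_ext (\<lambda>t. rename \<pi> (split_mon k t)) f"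
    by (simp add: rename_def split_at_def linear_ext_linear_ext)
  also have "\<dots> = linear_ext (\<lambda>t. split_mon (\<pi> k) (rename_mon \<pi> t)) f"
    using assms by (intro linear_ext_cong rename_split_mon) (auto simp: multilinear_def)
  also have "\<dots> = split_at (\<pi> k) (rename \<pi> f)"
    by (simp add: rename_def split_at_def linear_ext_linear_ext)
  finally show ?thesis .
qed

text \<open>Renaming turns \<open>split_at k f\<close> into
  \<open>split_at (\<pi> k) (rename \<pi> f)\<close>, which is again an axiom because
  \<open>k\<close> runs over all of \<open>{1..3}\<close>.\<close>

lemma quadratic_relations_pre:
  assumes "quadratic_relations \<sigma> \<epsilon> R"
  shows "quadratic_relations (pre_opp \<sigma>) (pre_sign \<epsilon>)
    (fs.span (pre_axioms R \<union> symmetries (pre_opp \<sigma>) (pre_sign \<epsilon>) 3))"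
    (is "quadratic_relations _ _ (fs.span ?G)")
  unfolding quadratic_relations_def
proof (intro conjI allI impI)
  have R: "R \<subseteq> multilinear 3" "\<And>\<pi> f. \<pi> permutes {1..3} \<Longrightarrow> f \<in> R \<Longrightarrow> rename \<pi> f \<in> R"
    using assms unfolding quadratic_relations_def by blast+
  show "fs.subspace (fs.span ?G)"
    by (rule fs.subspace_span)
  show "symmetries (pre_opp \<sigma>) (pre_sign \<epsilon>) 3 \<subseteq> fs.span ?G"
    by (auto intro: fs.span_base)
  show "fs.span ?G \<subseteq> multilinear 3"
    using R(1) symmetries_multilinear split_at_multilinear unfolding pre_axioms_def
    by (intro fs.span_minimal subspace_multilinear) blast
  fix \<pi> :: "nat \<Rightarrow> nat"
  assume \<pi>: "\<pi> permutes {1..3}"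
  have "rename \<pi> g \<in> fs.span ?G" if "g \<in> ?G" for g
    using that
  proof
    assume "g \<in> pre_axioms R"
    then obtain f k where "g = split_at k f" "f \<in> R" "k \<in> {1..3}"
      unfolding pre_axioms_def by blast
    then have "rename \<pi> g \<in> pre_axioms R"
      unfolding pre_axioms_def using R \<pi> rename_split_at permutes_in_image[OF \<pi>] by blast
    then show ?thesis
      by (auto intro: fs.span_base)
  next
    assume "g \<in> symmetries (pre_opp \<sigma>) (pre_sign \<epsilon>) 3"
    then show ?thesis
      using rename_symmetries[OF \<pi>] by (blast intro: fs.span_base)
  qed
  then show "rename \<pi> ` fs.span ?G \<subseteq> fs.span ?G"
    unfolding rename_def by (intro image_subsetI) (rule linear_ext_span[OF _ fs.subspace_span])
qed

text \<open>Since \<open>split_at k\<close> is linear and \<open>R\<close> is a subspace, all terms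
  with the same \<open>k\<close> combine into one.\<close>

lemma span_pre_axioms:
  assumes R: "fs.subspace R" and p: "p \<in> fs.span (pre_axioms R \<union> symmetries \<sigma> \<epsilon> n)"
  shows "\<exists>f1\<in>R. \<exists>f2\<in>R. \<exists>f3\<in>R. p - (split_at 1 f1 + split_at 2 f2 + split_at 3 f3) \<in> symmetries \<sigma> \<epsilon> n"
    (is "?P p")
  using p
proof (induction rule: fs.span_induct_alt)
  case base
  have "0 \<in> R" "0 \<in> symmetries \<sigma> \<epsilon> n"
    using R subspace_symmetries by (auto intro: fs.subspace_0)
  then show ?case
    by (intro bexI[of _ 0]) (auto simp: split_at_def)
next
  case (step c x y)
  have zero: "0 \<in> R" "0 \<in> symmetries \<sigma> \<epsilon> n"
    using R subspace_symmetries by (auto intro: fs.subspace_0)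
  have "?P x"
    using step(1)
  proof
    assume "x \<in> pre_axioms R"
    then obtain f k where x: "x = split_at k f" "f \<in> R" "k \<in> {1..3}"
      unfolding pre_axioms_def by blast
    then have "k = 1 \<or> k = 2 \<or> k = 3"
      by auto
    then have "x - (split_at 1 (if k = 1 then f else 0) + split_at 2 (if k = 2 then f else 0) +
        split_at 3 (if k = 3 then f else 0)) = 0"
      using x(1) by (auto simp: split_at_def)
    then have "x - (split_at 1 (if k = 1 then f else 0) + split_at 2 (if k = 2 then f else 0) +
        split_at 3 (if k = 3 then f else 0)) \<in> symmetries \<sigma> \<epsilon> n"
      using zero(2) by (simp only:)
    moreover have "(if k = i then f else 0) \<in> R" for i
      using x(2) zero(1) by simp
    ultimately show ?thesis
      by blast
  next
    assume "x \<in> symmetries \<sigma> \<epsilon> n"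
    then show ?thesis
      using zero(1) by (intro bexI[of _ 0]) (auto simp: split_at_def)
  qed
  then obtain f1 f2 f3 where f: "f1 \<in> R" "f2 \<in> R" "f3 \<in> R"
    "x - (split_at 1 f1 + split_at 2 f2 + split_at 3 f3) \<in> symmetries \<sigma> \<epsilon> n"
    by blast
  obtain g1 g2 g3 where g: "g1 \<in> R" "g2 \<in> R" "g3 \<in> R"
    "y - (split_at 1 g1 + split_at 2 g2 + split_at 3 g3) \<in> symmetries \<sigma> \<epsilon> n"
    using step(2) by blast
  have "scale c (x - (split_at 1 f1 + split_at 2 f2 + split_at 3 f3)) +
      (y - (split_at 1 g1 + split_at 2 g2 + split_at 3 g3)) \<in> symmetries \<sigma> \<epsilon> n"
    using f(4) g(4) subspace_symmetries by (intro fs.subspace_add fs.subspace_scale) auto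
  also have "scale c (x - (split_at 1 f1 + split_at 2 f2 + split_at 3 f3)) +
      (y - (split_at 1 g1 + split_at 2 g2 + split_at 3 g3)) =
      scale c x + y - (split_at 1 (scale c f1 + g1) + split_at 2 (scale c f2 + g2) + split_at 3 (scale c f3 + g3))"
    by (simp add: split_at_def fs.scale_right_distrib fs.scale_right_diff_distrib)
  finally have "scale c x + y - (split_at 1 (scale c f1 + g1) + split_at 2 (scale c f2 + g2) +
      split_at 3 (scale c f3 + g3)) \<in> symmetries \<sigma> \<epsilon> n" .
  moreover have "scale c f1 + g1 \<in> R" "scale c f2 + g2 \<in> R" "scale c f3 + g3 \<in> R"
    using f g R by (auto intro!: fs.subspace_add fs.subspace_scale)
  ultimately show ?case
    by blast
qed


section \<open>Removing the superscripts\<close>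

text \<open>If \<open>k\<close> is an inner letter, \<open>star_mon\<close> meets only letters and
  nothing is doubled. If \<open>k\<close> is external, the two terms of the starred inner product
  have the same bar.\<close>

lemma bar_split_mon:
  assumes "t \<in> multilinear_mons 3" "k \<in> {1..3}"
  shows "bar (split_mon k t) = mon_expr t + (if external_letter t k then mon_expr t else 0)"
  using assms(1)
proof (cases rule: multilinear_mons_3_cases)
  case (left i j a b c)
  then have "k = a \<or> k = b \<or> k = c"
    using assms(2) by blast
  then show ?thesis
    using left by (auto simp: bar_def external_letter_def)
next
  case (right i j a b c)
  then have "k = a \<or> k = b \<or> k = c"
    using assms(2) by blast
  then show ?thesis
    using right by (auto simp: bar_def external_letter_def)
qed

text \<open>
  In \<open>f\<^sup>(\<^sup>k\<^sup>)\<close> only the inner operation of the monomials with external letter \<open>x\<^sub>k\<close> becomes \<open>\<mu>\<^sup>*\<close>,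
  so exactly these monomials are doubled when the superscripts are removed.
\<close>

lemma bar_split_at:
  assumes "f \<in> multilinear 3" "k \<in> {1..3}"
  shows "bar (split_at k f) = f + proj k f"
proof -
  have "bar (split_at k f) = linear_ext (\<lambda>t. bar (split_mon k t)) f"
    by (simp add: bar_def split_at_def linear_ext_linear_ext)
  also have "\<dots> = linear_ext (\<lambda>t. mon_expr t + (if external_letter t k then mon_expr t else 0)) f"
    using assms by (intro linear_ext_cong bar_split_mon) (auto simp: multilinear_def)
  also have "\<dots> = f + proj k f"
    by (simp add: proj_def linear_ext_add_fun)
  finally show ?thesis .
qed

section \<open>Decomposition by the external letter\<close>

lemma external_letter_unique:
  "t \<in> multilinear_mons 3 \<Longrightarrow> \<exists>!k. k \<in> {1..3} \<and> external_letter t k"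
  by (cases rule: multilinear_mons_3_cases) (auto simp: external_letter_def)

lemma sum_proj:
  assumes "f \<in> multilinear 3"
  shows "proj 1 f + proj 2 f + proj 3 f = f"
proof -
  have "(if external_letter t 1 then mon_expr t else 0) + (if external_letter t 2 then mon_expr t else 0) +
      (if external_letter t 3 then mon_expr t else 0) = mon_expr t" if t: "t \<in> multilinear_mons 3" for t :: "'a mon"
  proof -
    obtain k where k: "k \<in> {1..3}" "external_letter t k"
      "\<And>l. l \<in> {1..3} \<Longrightarrow> external_letter t l \<Longrightarrow> l = k"
      using external_letter_unique[OF t] by blast
    then have "external_letter t l \<longleftrightarrow> l = k" if "l \<in> {1..3}" for l
      using that by blast
    then have "external_letter t 1 \<longleftrightarrow> k = 1" "external_letter t 2 \<longleftrightarrow> k = 2" "external_letter t 3 \<longleftrightarrow> k = 3"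
      by auto
    moreover have "k = 1 \<or> k = 2 \<or> k = 3"
      using k(1) by auto
    ultimately show ?thesis
      by auto
  qed
  then have "linear_ext (\<lambda>t. (if external_letter t 1 then mon_expr t else 0) +
      (if external_letter t 2 then mon_expr t else 0) + (if external_letter t 3 then mon_expr t else 0)) f =
      linear_ext mon_expr f"
    using assms unfolding multilinear_def by (intro linear_ext_cong) blast
  then show ?thesis
    by (simp add: proj_def linear_ext_add_fun)
qed

lemma proj_proj:
  assumes "f \<in> multilinear 3" "k \<in> {1..3}" "l \<in> {1..3}"
  shows "proj k (proj l f) = (if k = l then proj l f else 0)"
proof -
  have "proj k (proj l f) =
      linear_ext (\<lambda>t. if k = l then (if external_letter t l then mon_expr t else 0) else 0) f"
    unfolding proj_def linear_ext_linear_ext using assms external_letter_unique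
    by (intro linear_ext_cong) (auto simp: multilinear_def)
  then show ?thesis
    by (simp add: proj_def)
qed

lemma opp_step_bar:
  "opp_step (pre_opp \<sigma>) (pre_sign \<epsilon>) t c t' \<Longrightarrow> opp_step \<sigma> \<epsilon> (map_mon fst t) c (map_mon fst t')"
proof (induction rule: opp_step.induct)
  case (root j s t)
  then show ?case
    by (cases j) (auto simp: pre_sign_def intro: opp_step.root)
qed (auto intro: opp_step.intros)

lemma leaves_map_mon [simp]: "leaves (map_mon g t) = leaves t"
  by (induction t) simp_all

lemma bar_symmetries:
  "s \<in> symmetries (pre_opp \<sigma>) (pre_sign \<epsilon>) n \<Longrightarrow> bar s \<in> symmetries \<sigma> \<epsilon> n"
  unfolding bar_def
  by (rule symmetries_linear_ext) (auto simp: opp_step_bar multilinear_mons_def)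

lemma bar_multilinear: "\<Phi> \<in> multilinear n \<Longrightarrow> bar \<Phi> \<in> multilinear n"
  unfolding bar_def
  by (intro linear_ext_in_subspace subspace_multilinear) (auto simp: multilinear_def multilinear_mons_def)


section \<open>Initial algebras\<close>

lemma eval_mon_fst: "eval_mon (\<lambda>j. m (fst j)) a = (\<lambda>t. eval_mon m a (map_mon fst t))"
proof
  show "eval_mon (\<lambda>j. m (fst j)) a t = eval_mon m a (map_mon fst t)" for t
    by (induction t) simp_all
qed

lemma satisfies_bar: "satisfies A (\<lambda>j. m (fst j)) \<Phi> \<longleftrightarrow> satisfies A m (bar \<Phi>)"
  unfolding satisfies_def bar_def linear_ext_linear_ext by (simp add: eval_mon_fst)

text \<open>\<open>pre_opp\<close> also exchanges the halves, which is invisible when both act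
  alike.\<close>

lemma algebra_fst: "algebra \<sigma> \<epsilon> A m \<Longrightarrow> algebra (pre_opp \<sigma>) (pre_sign \<epsilon>) A (\<lambda>j. m (fst j))"
proof -
  have "fst (pre_opp \<sigma> j) = \<sigma> (fst j)" for j :: "'a \<times> half"
    by (cases j) simp
  then show "algebra \<sigma> \<epsilon> A m \<Longrightarrow> ?thesis"
    unfolding algebra_def pre_sign_def o_apply by (simp only:) blast
qed

lemma identities_trans:
  "p \<in> identities X \<sigma> \<epsilon> G \<Longrightarrow> G \<subseteq> identities X \<sigma> \<epsilon> H \<Longrightarrow> p \<in> identities X \<sigma> \<epsilon> H"
  unfolding identities_def by blast

text \<open>The defining condition is closed under consequences: a consequence of the initial axioms
  is an identity of preVar, and its bar is tested on algebras of Var with both halves acting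
  alike.\<close>

lemma initial_relations_eq:
  fixes X :: "'x itself" and \<epsilon> :: "'i \<Rightarrow> 'k::field"
  shows "initial_relations X \<sigma> \<epsilon> R = {\<Phi> \<in> multilinear 3.
    \<Phi> \<in> identities X (pre_opp \<sigma>) (pre_sign \<epsilon>) (pre_axioms R) \<and> bar \<Phi> \<in> identities X \<sigma> \<epsilon> R}"
proof -
  have "bar \<Phi> \<in> identities X \<sigma> \<epsilon> R"
    if "\<Phi> \<in> identities X (pre_opp \<sigma>) (pre_sign \<epsilon>) (initial_axioms X \<sigma> \<epsilon> R)" for \<Phi>
    unfolding identities_def mem_Collect_eq
  proof (intro allI impI)
    fix A :: "('x \<Rightarrow>\<^sub>0 'k) set" and m
    assume A: "algebra \<sigma> \<epsilon> A m \<and> (\<forall>g\<in>R. satisfies A m g)"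
    then have "\<forall>g\<in>initial_axioms X \<sigma> \<epsilon> R. satisfies A (\<lambda>j. m (fst j)) g"
      unfolding satisfies_bar initial_axioms_def identities_def by blast
    then have "satisfies A (\<lambda>j. m (fst j)) \<Phi>"
      using that A algebra_fst unfolding identities_def by blast
    then show "satisfies A m (bar \<Phi>)"
      by (simp only: satisfies_bar)
  qed
  moreover have "initial_axioms X \<sigma> \<epsilon> R \<subseteq> identities X (pre_opp \<sigma>) (pre_sign \<epsilon>) (pre_axioms R)"
    by (auto simp: initial_axioms_def)
  then have "\<Phi> \<in> identities X (pre_opp \<sigma>) (pre_sign \<epsilon>) (pre_axioms R)"
    if "\<Phi> \<in> identities X (pre_opp \<sigma>) (pre_sign \<epsilon>) (initial_axioms X \<sigma> \<epsilon> R)" for \<Phi>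
    using that identities_trans by blast
  moreover have "\<Phi> \<in> identities X (pre_opp \<sigma>) (pre_sign \<epsilon>) (initial_axioms X \<sigma> \<epsilon> R)"
    if "\<Phi> \<in> multilinear 3" "\<Phi> \<in> identities X (pre_opp \<sigma>) (pre_sign \<epsilon>) (pre_axioms R)"
      "bar \<Phi> \<in> identities X \<sigma> \<epsilon> R" for \<Phi>
  proof -
    have "\<Phi> \<in> initial_axioms X \<sigma> \<epsilon> R"
      using that unfolding initial_axioms_def by blast
    then show ?thesis
      unfolding identities_def by blast
  qed
  ultimately show ?thesis
    unfolding initial_relations_def by blast
qed

text \<open>The spaces of relations are represented by their preimages, so sums and components are
  compared modulo symmetries. The injection \<open>embed\<close> makes \<open>'x\<close> large
  enough for the truncated algebras.\<close>

theorem theorem1: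
  fixes \<sigma> :: "'i \<Rightarrow> 'i" and \<epsilon> :: "'i \<Rightarrow> 'k::field_char_0" and R :: "('i, 'k) expr set"
    and embed :: "('i \<times> half) mon \<Rightarrow> 'x"
  assumes "opposite_data \<sigma> \<epsilon>"
    and "quadratic_relations \<sigma> \<epsilon> R"
    and "inj embed"
  shows "initial_relations TYPE('x) \<sigma> \<epsilon> R =
    {\<Phi>. \<exists>f\<in>R. \<exists>f\<^sub>1\<in>R. \<exists>f\<^sub>2\<in>R. \<exists>f\<^sub>3\<in>R.
        equal_mod \<sigma> \<epsilon> 3 (proj 1 f\<^sub>1) (proj 1 f) \<and>
        equal_mod \<sigma> \<epsilon> 3 (proj 2 f\<^sub>2) (proj 2 f) \<and>
        equal_mod \<sigma> \<epsilon> 3 (proj 3 f\<^sub>3) (proj 3 f) \<and>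
        equal_mod (pre_opp \<sigma>) (pre_sign \<epsilon>) 3 \<Phi>
          (split_at 1 f\<^sub>1 + split_at 2 f\<^sub>2 + split_at 3 f\<^sub>3)}"
    (is "_ = ?rhs")
proof -
  let ?sym = "symmetries \<sigma> \<epsilon> 3" and ?pre_sym = "symmetries (pre_opp \<sigma>) (pre_sign \<epsilon>) 3"
  let ?S = "\<lambda>f1 f2 f3. split_at 1 f1 + split_at 2 f2 + split_at 3 f3"
  have R: "fs.subspace R" "?sym \<subseteq> R" "R \<subseteq> multilinear 3"
    using assms(2) by (auto simp: quadratic_relations_def)
  note R_add = fs.subspace_add[OF R(1)] and R_diff = fs.subspace_diff[OF R(1)]
  define P where "P = fs.span (pre_axioms R \<union> ?pre_sym)"
  \<comment> \<open>Attaching \<open>Succ\<close> to every operation embeds the monomials of Var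
    into those of preVar, so \<open>'x\<close> is large enough for Var too.\<close>
  have "inj (embed \<circ> map_mon (\<lambda>i. (i, Succ)))"
    using assms(3) by (intro inj_compose mon.inj_map) (auto simp: inj_def)
  then have Var: "multilinear 3 \<inter> identities TYPE('x) \<sigma> \<epsilon> R = R"
    by (rule identities_multilinear_3[OF assms(1,2)])
  have "multilinear 3 \<inter> identities TYPE('x) (pre_opp \<sigma>) (pre_sign \<epsilon>) P = P"
    unfolding P_def
    by (intro identities_multilinear_3[OF _ _ assms(3)] opposite_data_pre quadratic_relations_pre assms)
  then have preVar: "multilinear 3 \<inter> identities TYPE('x) (pre_opp \<sigma>) (pre_sign \<epsilon>) (pre_axioms R) = P"
    by (simp add: P_def identities_span_symmetries)
  have initial: "initial_relations TYPE('x) \<sigma> \<epsilon> R = {\<Phi> \<in> P. bar \<Phi> \<in> R}"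
    unfolding initial_relations_eq using Var preVar bar_multilinear by blast
  \<comment> \<open>Modulo symmetries the bar of the sum is \<open>f1 + f2 + f3\<close> plus the
    three projections, and \<open>f1 + f2 + f3\<close> already lies in \<open>R\<close>.\<close>
  have bar_iff: "bar \<Phi> \<in> R \<longleftrightarrow> proj 1 f1 + proj 2 f2 + proj 3 f3 \<in> R"
    if f: "f1 \<in> R" "f2 \<in> R" "f3 \<in> R" and \<Phi>: "\<Phi> - ?S f1 f2 f3 \<in> ?pre_sym" for \<Phi> f1 f2 f3
  proof -
    let ?p = "proj 1 f1 + proj 2 f2 + proj 3 f3"
    have "bar (\<Phi> - ?S f1 f2 f3) \<in> R"
      using bar_symmetries[OF \<Phi>] R(2) by blast
    moreover have "bar (\<Phi> - ?S f1 f2 f3) =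
        bar \<Phi> - (bar (split_at 1 f1) + bar (split_at 2 f2) + bar (split_at 3 f3))"
      by (simp add: bar_def)
    moreover have "f1 \<in> multilinear 3" "f2 \<in> multilinear 3" "f3 \<in> multilinear 3"
      using f R(3) by auto
    ultimately have "bar \<Phi> - ((f1 + proj 1 f1) + (f2 + proj 2 f2) + (f3 + proj 3 f3)) \<in> R"
      by (simp add: bar_split_at)
    then have "bar \<Phi> - ((f1 + proj 1 f1) + (f2 + proj 2 f2) + (f3 + proj 3 f3)) + (f1 + f2 + f3) \<in> R"
      using f by (intro R_add)
    then have diff: "bar \<Phi> - ?p \<in> R"
      by (simp add: algebra_simps)
    have "bar \<Phi> - ?p + ?p = bar \<Phi>" "bar \<Phi> - (bar \<Phi> - ?p) = ?p"
      by simp_all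
    with diff show ?thesis
      by (metis R_add R_diff)
  qed
  show ?thesis
    unfolding initial
  proof (intro equalityI subsetI)
    fix \<Phi>
    assume \<Phi>: "\<Phi> \<in> {\<Phi> \<in> P. bar \<Phi> \<in> R}"
    then obtain f1 f2 f3 where f: "f1 \<in> R" "f2 \<in> R" "f3 \<in> R" "\<Phi> - ?S f1 f2 f3 \<in> ?pre_sym"
      using span_pre_axioms[OF R(1)] unfolding P_def by blast
    \<comment> \<open>The witness for \<open>f\<close>: the element whose components are the
      prescribed ones, so the three congruences hold as equalities.\<close>
    define g where "g = proj 1 f1 + proj 2 f2 + proj 3 f3"
    have "g \<in> R"
      using bar_iff[OF f] \<Phi> by (simp add: g_def)
    have proj_add: "proj k (p + q) = proj k p + proj k q" for k and p q :: "('i, 'k) expr"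
      by (simp add: proj_def)
    have "f1 \<in> multilinear 3" "f2 \<in> multilinear 3" "f3 \<in> multilinear 3"
      using f R(3) by auto
    then have "proj 1 f1 = proj 1 g" "proj 2 f2 = proj 2 g" "proj 3 f3 = proj 3 g"
      by (simp_all add: g_def proj_add proj_proj)
    then have "proj 1 f1 - proj 1 g \<in> ?sym" "proj 2 f2 - proj 2 g \<in> ?sym" "proj 3 f3 - proj 3 g \<in> ?sym"
      by (simp_all add: fs.subspace_0[OF subspace_symmetries])
    then show "\<Phi> \<in> ?rhs"
      using f \<open>g \<in> R\<close> unfolding equal_mod_def by blast
  next
    fix \<Phi>
    assume "\<Phi> \<in> ?rhs"
    then obtain f f1 f2 f3 where f: "f \<in> R" "f1 \<in> R" "f2 \<in> R" "f3 \<in> R"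
      and eq: "proj 1 f1 - proj 1 f \<in> ?sym" "proj 2 f2 - proj 2 f \<in> ?sym" "proj 3 f3 - proj 3 f \<in> ?sym"
      and \<Phi>: "\<Phi> - ?S f1 f2 f3 \<in> ?pre_sym"
      unfolding equal_mod_def by blast
    \<comment> \<open>Adding \<open>f\<close>, the sum of its own components, leaves the three
      projections of the \<open>f_k\<close>.\<close>
    have "(proj 1 f1 - proj 1 f) + (proj 2 f2 - proj 2 f) + (proj 3 f3 - proj 3 f) + f \<in> R"
      using eq f R(2) by (intro R_add) auto
    also have "(proj 1 f1 - proj 1 f) + (proj 2 f2 - proj 2 f) + (proj 3 f3 - proj 3 f) + f =
        proj 1 f1 + proj 2 f2 + proj 3 f3"
      using sum_proj[of f] f(1) R(3) by (auto simp: algebra_simps)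
    finally have "bar \<Phi> \<in> R"
      using bar_iff[OF f(2-4) \<Phi>] by blast
    moreover have "split_at k h \<in> P" if "k \<in> {1..3}" "h \<in> R" for k h
      using that unfolding P_def pre_axioms_def by (auto intro!: fs.span_base)
    then have "?S f1 f2 f3 \<in> P"
      using f unfolding P_def by (intro fs.span_add) auto
    then have "\<Phi> - ?S f1 f2 f3 + ?S f1 f2 f3 \<in> P"
      using \<Phi> unfolding P_def by (blast intro: fs.span_add fs.span_base)
    ultimately show "\<Phi> \<in> {\<Phi> \<in> P. bar \<Phi> \<in> R}"
      by simp
  qed
qed

end
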